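(* There is a constant $c>1/2$ such that for every integer $m\ge 2$ there exists $n_0=n_0(m)$ such that for every integer $n\ge n_0$ there exists a subset $A\subseteq \mathbb{Z}_m^n$ of size $|A|\ge (cm)^n$ not containing a three-term arithmetic progression. (The constant $c$ is absolute, i.e. independent of $m$ and $n$.)
   Context: $\mathbb{Z}_m=\mathbb{Z}/m\mathbb{Z}$ denotes the integers modulo $m$. A three-term arithmetic progression in $\mathbb{Z}_m^n$ consists of three distinct elements $x,y,z\in \mathbb{Z}_m^n$ with $x-2y+z=0$. A subset $A$ does not contain a three-term arithmetic progression if there are no three (pairwise) distinct elements $x,y,z\in A$ with $x-2y+z=0$. *)

theory Defs
  imports Complex_Main "HOL-Algebra.Product_Groups"
begin

definition Zmod_power :: "nat \<Rightarrow> nat \<Rightarrow> (nat \<Rightarrow> int) monoid" where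
  "Zmod_power m n = product_group {..<n} (\<lambda>_. integer_mod_group m)"

text \<open>HOL-Algebra writes abelian groups multiplicatively, so the equation below is
  \<open>x - 2y + z = 0\<close>.\<close>

definition three_term_ap :: "('a, 'b) monoid_scheme \<Rightarrow> 'a \<Rightarrow> 'a \<Rightarrow> 'a \<Rightarrow> bool" where
  "three_term_ap G x y z \<longleftrightarrow>
     x \<in> carrier G \<and> y \<in> carrier G \<and> z \<in> carrier G \<and>
     x \<noteq> y \<and> y \<noteq> z \<and> x \<noteq> z \<and>
     x \<otimes>\<^bsub>G\<^esub> inv\<^bsub>G\<^esub> (y [^]\<^bsub>G\<^esub> (2::nat)) \<otimes>\<^bsub>G\<^esub> z = \<one>\<^bsub>G\<^esub>"

definition three_term_ap_free :: "('a, 'b) monoid_scheme \<Rightarrow> 'a set \<Rightarrow> bool" where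
  "three_term_ap_free G A \<longleftrightarrow> \<not> (\<exists>x\<in>A. \<exists>y\<in>A. \<exists>z\<in>A. three_term_ap G x y z)"

end

theory Submission
  imports Defs
begin

text \<open>
  Suppose \<open>S\<close> is a set of letters in \<open>\<int>\<^sub>m\<^sup>2\<close> carrying a weight \<open>f\<close> with \<open>2 f(q) < f(p) + f(r)\<close> whenever
  \<open>p + r = 2q\<close> and \<open>p \<noteq> r\<close>. Then the words over \<open>S\<close> with a prescribed total weight form a
  progression-free set, and by pigeonhole one of these sets is as large as \<open>|S|\<^sup>N\<close> up to a factor
  linear in \<open>N\<close>. It therefore suffices to find weighted sets with \<open>|S| \<ge> (c'm)\<^sup>2\<close> for some
  \<open>c' > 1/2\<close>. For bounded \<open>m\<close> the box \<open>{0..m div 2}\<^sup>2\<close> with a strictly convex weight will do, as it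
  has slightly more than \<open>(m/2)\<^sup>2\<close> points.

  For large \<open>m\<close>, take \<open>S\<close> to be roughly the union over the first coordinate \<open>a/m\<close> of
  slices \<open>{x. 2x mod m \<ge> 3m/4}\<close> for \<open>a/m\<close> in \<open>[0, 1/8)\<close>, \<open>{x. 2x mod m \<ge> m/2}\<close> in
  \<open>[1/8, 1/4)\<close>, \<open>{x. x < m/2}\<close> in \<open>[1/4, 1/2)\<close> and \<open>{x. x < m/4}\<close> in \<open>[1/2, 3/4)\<close>, which has
  density \<open>9/32 > 1/4\<close>. The weight is lexicographic: first \<open>(m - a)\<^sup>2\<close>, then a strictly convex
  function within each slice. As \<open>(m - a)\<^sup>2\<close> is strictly convex and decreasing, it only fails for
  triples with \<open>a + c = 2b + m\<close>, and for these the slices are chosen such that \<open>x + z\<close> is too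
  small to equal \<open>2y mod m\<close>.
\<close>

section \<open>Weights on pairs of residues\<close>

text \<open>The second disjunct admits the solutions with \<open>p = r\<close>, where for even
  \<open>m\<close> the point \<open>q\<close> may differ from \<open>p\<close> by an element of
  order two. Its weak bound suffices for weights to be added over coordinates.\<close>

definition midpoint_weight :: "int \<Rightarrow> (int \<times> int) set \<Rightarrow> (int \<times> int \<Rightarrow> int) \<Rightarrow> bool" where
  "midpoint_weight m S f \<longleftrightarrow>
     (\<forall>p\<in>S. \<forall>q\<in>S. \<forall>r\<in>S.
        m dvd fst p + fst r - 2 * fst q \<longrightarrow> m dvd snd p + snd r - 2 * snd q \<longrightarrow>
        2 * f q < f p + f r \<or> p = r \<and> f q \<le> f p)"

lemma midpoint_weightD:
  assumes "midpoint_weight m S f" "p \<in> S" "q \<in> S" "r \<in> S"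
    and "m dvd fst p + fst r - 2 * fst q" "m dvd snd p + snd r - 2 * snd q"
  shows "2 * f q \<le> f p + f r" and "f p + f r \<le> 2 * f q \<Longrightarrow> p = r"
  using assms unfolding midpoint_weight_def by (smt (verit))+

lemma dvd_abs_less_2_cases:
  fixes m t :: int
  assumes "m dvd t" "\<bar>t\<bar> < 2 * m"
  shows "t = - m \<or> t = 0 \<or> t = m"
proof -
  obtain k where k: "t = m * k" using assms(1) by auto
  have "m > 0" using assms(2) by linarith
  then have "\<bar>k\<bar> < 2" using assms(2) unfolding k by (simp add: abs_mult mult.commute)
  then have "k = -1 \<or> k = 0 \<or> k = 1" by linarith
  then show ?thesis using k by auto
qed

lemma sum_squares_midpoint:
  fixes x y z :: int
  assumes "x + z = 2 * y"
  shows "x\<^sup>2 + z\<^sup>2 = 2 * y\<^sup>2 + 2 * (x - y)\<^sup>2"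
proof -
  have z: "z = 2 * y - x" using assms by simp
  show ?thesis unfolding z by (simp add: power2_eq_square algebra_simps)
qed

text \<open>In one coordinate of the box a wrap-around needs \<open>2 * k = m\<close>, with
  \<open>a = c\<close> at one end and \<open>b\<close> at the other. Centring the square at
  \<open>k / 2\<close> gives both ends the same weight.\<close>

lemma midpoint_weight_half_box:
  fixes m k :: int
  assumes "0 \<le> k" "2 * k \<le> m" "0 < m"
  shows "midpoint_weight m ({0..k} \<times> {0..k}) (\<lambda>(a, x). (2 * a - k)\<^sup>2 + (2 * x - k)\<^sup>2)"
proof -
  have coord: "2 * (2 * b - k)\<^sup>2 < (2 * a - k)\<^sup>2 + (2 * c - k)\<^sup>2 \<or>
      a = c \<and> (2 * b - k)\<^sup>2 = (2 * a - k)\<^sup>2"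
    if "a \<in> {0..k}" "b \<in> {0..k}" "c \<in> {0..k}" "m dvd a + c - 2 * b" for a b c
  proof -
    have "a + c - 2 * b = - m \<or> a + c - 2 * b = 0 \<or> a + c - 2 * b = m"
      using that assms by (intro dvd_abs_less_2_cases) auto
    then have "a = 0 \<and> c = 0 \<and> b = k \<or> a + c = 2 * b \<or> a = k \<and> c = k \<and> b = 0"
      using that(1-3) assms by auto
    then consider "a = 0" "c = 0" "b = k" | "a + c = 2 * b" | "a = k" "c = k" "b = 0"
      by blast
    then show ?thesis
    proof cases
      case 2
      have "(2 * a - k) + (2 * c - k) = 2 * (2 * b - k)" using 2 by simp
      from sum_squares_midpoint[OF this] 2 show ?thesis
        by (cases "a = b") auto
    qed (auto simp: power2_eq_square)
  qed
  show ?thesis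
    unfolding midpoint_weight_def
  proof (intro ballI impI)
    fix p q r
    assume "p \<in> {0..k} \<times> {0..k}" "q \<in> {0..k} \<times> {0..k}" "r \<in> {0..k} \<times> {0..k}"
      and dv: "m dvd fst p + fst r - 2 * fst q" "m dvd snd p + snd r - 2 * snd q"
    then have "fst p \<in> {0..k}" "fst q \<in> {0..k}" "fst r \<in> {0..k}"
      "snd p \<in> {0..k}" "snd q \<in> {0..k}" "snd r \<in> {0..k}" by auto
    note coord[OF this(1-3) dv(1)] coord[OF this(4-6) dv(2)]
    then show "2 * (case q of (a, x) \<Rightarrow> (2 * a - k)\<^sup>2 + (2 * x - k)\<^sup>2)
          < (case p of (a, x) \<Rightarrow> (2 * a - k)\<^sup>2 + (2 * x - k)\<^sup>2) +
            (case r of (a, x) \<Rightarrow> (2 * a - k)\<^sup>2 + (2 * x - k)\<^sup>2) \<or>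
        p = r \<and> (case q of (a, x) \<Rightarrow> (2 * a - k)\<^sup>2 + (2 * x - k)\<^sup>2)
          \<le> (case p of (a, x) \<Rightarrow> (2 * a - k)\<^sup>2 + (2 * x - k)\<^sup>2)"
      by (cases p, cases q, cases r) auto
  qed
qed

section \<open>The staircase set, its weight and its size\<close>

text \<open>
  Here \<open>q\<close> stands for \<open>m / 16\<close>. For \<open>a < 4 * q\<close> the two intervals are the two halves of the
  preimage of \<open>[m - 2 * t, m)\<close> under doubling modulo \<open>m\<close>.
\<close>

definition staircase :: "int \<Rightarrow> int \<Rightarrow> (int \<times> int) set" where
  "staircase m q = {(a, x). 0 \<le> a \<and> a < (m + 1) div 2 + 4 * q \<and> 0 \<le> x \<and> x < m \<and>
     (if a < 4 * q
      then let t = (if a < 2 * q then 2 * q else 4 * q)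
           in (m + 1) div 2 - t \<le> x \<and> x < (m + 1) div 2 \<or> m - t \<le> x
      else x < (if a < (m + 1) div 2 then 8 * q else 4 * q))}"

text \<open>
  The factor \<open>2 * m\<^sup>2 + 1\<close> makes the first summand dominate, since the second one is at most \<open>m\<^sup>2\<close>.
  The weight \<open>(2 * x mod m)\<^sup>2\<close> is a function of \<open>2 * x\<close>, so it takes the same value at \<open>x\<close> and
  \<open>x + m / 2\<close> for even \<open>m\<close>, as the degenerate solutions \<open>p = r \<noteq> q\<close> require.
\<close>

definition staircase_weight :: "int \<Rightarrow> int \<Rightarrow> int \<times> int \<Rightarrow> int" where
  "staircase_weight m q = (\<lambda>(a, x).
     (2 * m\<^sup>2 + 1) * (m - a)\<^sup>2 + (if a < 4 * q then (2 * x mod m)\<^sup>2 else x\<^sup>2))"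

lemma staircase_double:
  assumes "(a, x) \<in> staircase m q" "16 * q \<le> m" "0 < q"
  shows "a < 4 * q \<Longrightarrow> m - 8 * q \<le> 2 * x mod m"
    and "a < 2 * q \<Longrightarrow> m - 4 * q \<le> 2 * x mod m"
proof -
  have "2 * x mod m = (if 2 * x < m then 2 * x else 2 * x - m)"
    using assms by (auto simp: staircase_def intro!: int_mod_pos_eq[where q = 1])
  then show "a < 4 * q \<Longrightarrow> m - 8 * q \<le> 2 * x mod m" "a < 2 * q \<Longrightarrow> m - 4 * q \<le> 2 * x mod m"
    using assms unfolding staircase_def by (auto simp: Let_def split: if_splits)
qed

text \<open>If \<open>a\<close> and \<open>c\<close> are both at least \<open>h\<close>, then
  \<open>x + z < 8 * q <= m - 8 * q\<close>. Otherwise exactly one is below \<open>h\<close>, which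
  forces \<open>b < 2 * q\<close>, and \<open>x + z < 12 * q <= m - 4 * q\<close>.\<close>

lemma staircase_no_wrap_up:
  assumes S: "(a, x) \<in> staircase m q" "(b, y) \<in> staircase m q" "(c, z) \<in> staircase m q"
    and q: "16 * q \<le> m" "0 < q"
    and abc: "a + c = 2 * b + m"
    and dv: "m dvd x + z - 2 * y"
  shows False
proof -
  define h where "h = (m + 1) div 2"
  have h: "m \<le> 2 * h" "2 * h \<le> m + 1" unfolding h_def by auto
  have bnd: "0 \<le> a" "a < h + 4 * q" "0 \<le> c" "c < h + 4 * q" "0 \<le> b" "0 \<le> x" "0 \<le> z"
    using S unfolding staircase_def h_def by auto
  have slice: "4 * q \<le> s \<Longrightarrow> t < 8 * q" "h \<le> s \<Longrightarrow> t < 4 * q" if "(s, t) \<in> staircase m q" for s t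
    using that q h unfolding staircase_def h_def[symmetric] by (auto split: if_splits)
  have b: "b < 4 * q" using abc bnd h by linarith
  have ac: "4 * q \<le> a" "4 * q \<le> c" using abc bnd h q by linarith+
  have eq: "2 * y mod m = (x + z) mod m"
    using dv by (simp add: mod_eq_dvd_iff dvd_diff_commute)
  have xz: "x + z < 16 * q" using slice[OF S(1)] slice[OF S(3)] ac by linarith
  then have eq: "2 * y mod m = x + z" using eq q bnd by (simp add: mod_pos_pos_trivial)
  show False
  proof (cases "h \<le> a \<and> h \<le> c")
    case True
    then have "x + z < 8 * q" using slice[OF S(1)] slice[OF S(3)] by linarith
    then show False using staircase_double(1)[OF S(2) q b] eq q by linarith
  next
    case False
    then have "b < 2 * q" using abc bnd h by linarith
    moreover have "h \<le> a \<or> h \<le> c" using abc bnd h by linarith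
    then have "x + z < 12 * q" using slice[OF S(1)] slice[OF S(3)] ac by linarith
    ultimately show False using staircase_double(2)[OF S(2) q] eq q by linarith
  qed
qed

text \<open>A congruence becomes an integer equation once its terms lie in a window of length
  \<open>8 * q <= m / 2\<close>. This holds for the doubled residues if \<open>a < 4 * q\<close>,
  and for the letters themselves otherwise.\<close>

lemma staircase_slice:
  assumes S: "(a, x) \<in> staircase m q" "(a, y) \<in> staircase m q" "(a, z) \<in> staircase m q"
    and q: "16 * q \<le> m" "0 < q"
    and dv: "m dvd x + z - 2 * y"
  shows "2 * staircase_weight m q (a, y) < staircase_weight m q (a, x) + staircase_weight m q (a, z) \<or>
    x = z \<and> staircase_weight m q (a, y) = staircase_weight m q (a, x)"
proof (cases "a < 4 * q")
  case True
  define u v w where uvw: "u = 2 * x mod m" "v = 2 * y mod m" "w = 2 * z mod m"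
  have bnd: "u < m" "v < m" "w < m" "m - 8 * q \<le> u" "m - 8 * q \<le> v" "m - 8 * q \<le> w"
    using S[THEN staircase_double(1), OF q True] q unfolding uvw by auto
  have "m dvd 2 * (x + z - 2 * y)" using dv by (rule dvd_mult)
  moreover have du: "m dvd 2 * x - u" and dw: "m dvd 2 * z - w"
    unfolding uvw by (simp_all only: dvd_minus_mod)
  moreover have dv': "m dvd 2 * y - v"
    unfolding uvw by (rule dvd_minus_mod)
  ultimately have "m dvd 2 * (x + z - 2 * y) - (2 * x - u) - (2 * z - w) + 2 * (2 * y - v)"
    by (metis dvd_add dvd_diff dvd_mult)
  moreover have "2 * (x + z - 2 * y) - (2 * x - u) - (2 * z - w) + 2 * (2 * y - v) = u + w - 2 * v"
    by simp
  ultimately have "m dvd u + w - 2 * v" by (simp only:)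
  then have "u + w - 2 * v = - m \<or> u + w - 2 * v = 0 \<or> u + w - 2 * v = m"
    using bnd q by (intro dvd_abs_less_2_cases) auto
  then have sum: "u + w = 2 * v" using bnd q by linarith
  note sq = sum_squares_midpoint[OF sum]
  show ?thesis
  proof (cases "u = v")
    case False
    then show ?thesis using sq True unfolding staircase_weight_def uvw by auto
  next
    case uv: True
    \<comment> \<open>Here \<open>2 * y\<close> is congruent to \<open>2 * x\<close>, so only
      \<open>x = z\<close> can be concluded; \<open>y\<close> may still differ by
      \<open>m / 2\<close>.\<close>
    have "m dvd (x + z - 2 * y) + (2 * y - v) - (2 * x - u)"
      by (rule dvd_diff[OF dvd_add[OF dv dv'] du])
    then have "m dvd z - x" using uv by (simp add: algebra_simps)
    moreover have "\<bar>z - x\<bar> < m" using S unfolding staircase_def by auto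
    ultimately have "z = x" using zdvd_imp_le by (smt (verit) dvd_minus_iff)
    then show ?thesis using uv True unfolding staircase_weight_def uvw by auto
  qed
next
  case False
  then have bnd: "0 \<le> x" "0 \<le> y" "0 \<le> z" "x < 8 * q" "y < 8 * q" "z < 8 * q"
    using S q unfolding staircase_def by (auto split: if_splits)
  then have "x + z - 2 * y = - m \<or> x + z - 2 * y = 0 \<or> x + z - 2 * y = m"
    using dv q by (intro dvd_abs_less_2_cases) auto
  then have sum: "x + z = 2 * y" using bnd q by linarith
  from sum_squares_midpoint[OF this] False sum show ?thesis
    by (cases "x = y") (auto simp: staircase_weight_def)
qed

lemma staircase_weight_bounds:
  assumes "(a, x) \<in> staircase m q" "16 * q \<le> m" "0 < q"
  shows "(2 * m\<^sup>2 + 1) * (m - a)\<^sup>2 \<le> staircase_weight m q (a, x)"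
    and "staircase_weight m q (a, x) \<le> (2 * m\<^sup>2 + 1) * (m - a)\<^sup>2 + m\<^sup>2"
  using assms by (auto simp: staircase_weight_def staircase_def intro!: power_mono less_imp_le)

lemma midpoint_weight_staircase:
  assumes q: "16 * q \<le> m" "0 < q"
  shows "midpoint_weight m (staircase m q) (staircase_weight m q)"
  unfolding midpoint_weight_def
proof (intro ballI impI)
  fix p1 p2 p3
  assume "p1 \<in> staircase m q" "p2 \<in> staircase m q" "p3 \<in> staircase m q"
    and dvs: "m dvd fst p1 + fst p3 - 2 * fst p2" "m dvd snd p1 + snd p3 - 2 * snd p2"
  moreover obtain a x b y c z where p: "p1 = (a, x)" "p2 = (b, y)" "p3 = (c, z)"
    by (metis surj_pair)
  ultimately have S: "(a, x) \<in> staircase m q" "(b, y) \<in> staircase m q" "(c, z) \<in> staircase m q"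
    and dva: "m dvd a + c - 2 * b" and dvx: "m dvd x + z - 2 * y" by auto
  have bnd: "0 \<le> a" "a < m" "0 \<le> b" "b < m" "0 \<le> c" "c < m"
    using S q unfolding staircase_def by auto
  then have "a + c - 2 * b = - m \<or> a + c - 2 * b = 0 \<or> a + c - 2 * b = m"
    using dva by (intro dvd_abs_less_2_cases) auto
  moreover have "a + c \<noteq> 2 * b + m"
    using staircase_no_wrap_up[OF S q _ dvx] by blast
  ultimately have abc: "a + c = 2 * b - m \<or> a + c = 2 * b" by linarith
  show "2 * staircase_weight m q p2 < staircase_weight m q p1 + staircase_weight m q p3 \<or>
    p1 = p3 \<and> staircase_weight m q p2 \<le> staircase_weight m q p1"
  proof (cases "a = b \<and> b = c")
    case True
    then show ?thesis using staircase_slice[of a x m q y z] S q dvx p by auto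
  next
    case False
    have "2 * (m - b)\<^sup>2 < (m - a)\<^sup>2 + (m - c)\<^sup>2"
    proof (cases "a + c = 2 * b")
      case True
      have "(m - a) + (m - c) = 2 * (m - b)" using True by simp
      from sum_squares_midpoint[OF this] True False show ?thesis by auto
    next
      \<comment> \<open>A downward wrap puts both \<open>a\<close> and \<open>c\<close> below
        \<open>b\<close>, where the decreasing first summand is larger.\<close>
      case wrap: False
      then have "m - b < m - a" "m - b < m - c" using abc bnd by linarith+
      then have "(m - b)\<^sup>2 < (m - a)\<^sup>2" "(m - b)\<^sup>2 < (m - c)\<^sup>2"
        using bnd by (auto intro!: power_strict_mono)
      then show ?thesis by linarith
    qed
    then have "1 \<le> (m - a)\<^sup>2 + (m - c)\<^sup>2 - 2 * (m - b)\<^sup>2" by linarith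
    moreover define K where "K = 2 * m\<^sup>2 + 1"
    ultimately have "K * 1 \<le> K * ((m - a)\<^sup>2 + (m - c)\<^sup>2 - 2 * (m - b)\<^sup>2)"
      by (intro mult_left_mono) auto
    also have "\<dots> = K * (m - a)\<^sup>2 + K * (m - c)\<^sup>2 - 2 * (K * (m - b)\<^sup>2)"
      by (simp add: distrib_left right_diff_distrib)
    finally have "2 * staircase_weight m q p2 < staircase_weight m q p1 + staircase_weight m q p3"
      using S[THEN staircase_weight_bounds(1), OF q, folded K_def]
        staircase_weight_bounds(2)[OF S(2) q, folded K_def] K_def
      unfolding p by linarith
    then show ?thesis ..
  qed
qed

lemma finite_staircase: "finite (staircase m q)"
  by (rule finite_subset[of _ "{0..<(m + 1) div 2 + 4 * q} \<times> {0..<m}"]) (auto simp: staircase_def)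

lemma card_staircase:
  assumes q: "16 * q \<le> m" "0 < q"
  shows "72 * q\<^sup>2 \<le> int (card (staircase m q))"
proof -
  define h where "h = (m + 1) div 2"
  have h: "m \<le> 2 * h" "2 * h \<le> m + 1" unfolding h_def by auto
  \<comment> \<open>The blocks have 8, 16, 32 and 16 times \<open>q\<^sup>2\<close> points;
    \<open>8 * q <= h\<close> keeps \<open>?B3\<close> and \<open>?B4\<close> disjoint.\<close>
  let ?B1 = "{0..<2*q} \<times> ({h-2*q..<h} \<union> {m-2*q..<m})"
  let ?B2 = "{2*q..<4*q} \<times> ({h-4*q..<h} \<union> {m-4*q..<m})"
  let ?B3 = "{4*q..<8*q} \<times> {0..<8*q}"
  let ?B4 = "{h..<h+4*q} \<times> {0..<4*q}"
  have sub: "?B1 \<union> (?B2 \<union> (?B3 \<union> ?B4)) \<subseteq> staircase m q"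
    using q h unfolding staircase_def h_def[symmetric] by (auto simp: Let_def)
  have "?B1 \<inter> (?B2 \<union> (?B3 \<union> ?B4)) = {}" "?B2 \<inter> (?B3 \<union> ?B4) = {}" "?B3 \<inter> ?B4 = {}"
    using q h by auto
  then have "card (?B1 \<union> (?B2 \<union> (?B3 \<union> ?B4))) = card ?B1 + (card ?B2 + (card ?B3 + card ?B4))"
    by (simp add: card_Un_disjoint)
  moreover have "card ({h-2*q..<h} \<union> {m-2*q..<m}) = nat (4 * q)"
    using q h by (subst card_Un_disjoint) auto
  moreover have "card ({h-4*q..<h} \<union> {m-4*q..<m}) = nat (8 * q)"
    using q h by (subst card_Un_disjoint) auto
  ultimately have "int (card (?B1 \<union> (?B2 \<union> (?B3 \<union> ?B4)))) = 72 * q\<^sup>2"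
    using q by (simp add: card_cartesian_product power2_eq_square)
  then show ?thesis using card_mono[OF finite_staircase sub] by simp
qed

section \<open>From weighted letters to progression-free sets of words\<close>

lemma carrier_Zmod_power:
  "0 < m \<Longrightarrow> carrier (Zmod_power m n) = PiE {..<n} (\<lambda>_. {0..<int m})"
  by (simp add: Zmod_power_def carrier_integer_mod_group)

lemma three_term_ap_Zmod_powerD:
  assumes "three_term_ap (Zmod_power m n) x y z" "i < n" "0 < m"
  shows "int m dvd x i + z i - 2 * y i"
proof -
  let ?G = "integer_mod_group m"
  let ?P = "Zmod_power m n"
  interpret Z: group ?G by simp
  interpret P: group ?P unfolding Zmod_power_def by simp
  have xyz: "x \<in> carrier ?P" "y \<in> carrier ?P" "z \<in> carrier ?P"
    and eq: "x \<otimes>\<^bsub>?P\<^esub> inv\<^bsub>?P\<^esub> (y [^]\<^bsub>?P\<^esub> (2::nat)) \<otimes>\<^bsub>?P\<^esub> z = \<one>\<^bsub>?P\<^esub>"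
    using assms(1) unfolding three_term_ap_def by auto
  have yi: "y i \<in> carrier ?G" using xyz(2) assms(2) unfolding Zmod_power_def by auto
  have "(x \<otimes>\<^bsub>?P\<^esub> inv\<^bsub>?P\<^esub> (y [^]\<^bsub>?P\<^esub> (2::nat)) \<otimes>\<^bsub>?P\<^esub> z) i = \<one>\<^bsub>?P\<^esub> i" using eq by simp
  moreover have "y [^]\<^bsub>?P\<^esub> (2::nat) = y \<otimes>\<^bsub>?P\<^esub> y"
    using xyz(2) by (simp add: numeral_2_eq_2)
  moreover have "y \<otimes>\<^bsub>?P\<^esub> y \<in> carrier ?P" using xyz(2) by simp
  ultimately have "x i \<otimes>\<^bsub>?G\<^esub> inv\<^bsub>?G\<^esub> (y i \<otimes>\<^bsub>?G\<^esub> y i) \<otimes>\<^bsub>?G\<^esub> z i = \<one>\<^bsub>?G\<^esub>"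
    using assms(2) unfolding Zmod_power_def by simp
  then have "((x i + (- ((y i + y i) mod int m)) mod int m) mod int m + z i) mod int m = 0"
    using inv_integer_mod_group[OF Z.m_closed[OF yi yi]] by simp
  then have "(x i + z i - 2 * y i) mod int m = 0"
    by (simp add: mod_simps algebra_simps)
  then show ?thesis by auto
qed

lemma exists_three_term_ap_free_of_midpoint_weight:
  assumes m: "0 < m" and S: "S \<subseteq> {0..<int m} \<times> {0..<int m}"
    and mw: "midpoint_weight (int m) S f"
    and f: "\<And>p. p \<in> S \<Longrightarrow> 0 \<le> f p \<and> f p \<le> int F"
  shows "\<exists>A. A \<subseteq> carrier (Zmod_power m n) \<and> three_term_ap_free (Zmod_power m n) A \<and>
    card S ^ (n div 2) \<le> card A * (n div 2 * F + 1)"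
proof -
  define N where "N = n div 2"
  define W where "W = PiE {..<N} (\<lambda>_. S)"
  define wt where "wt w = (\<Sum>i<N. f (w i))" for w
  \<comment> \<open>Letter \<open>j\<close> fills coordinates \<open>2 * j\<close> and
    \<open>2 * j + 1\<close>; for odd \<open>n\<close> the last coordinate is 0.\<close>
  define E where "E w = (\<lambda>i\<in>{..<n}.
      if i div 2 < N then (if even i then fst else snd) (w (i div 2)) else (0::int))" for w
  have finS: "finite S" using S by (rule finite_subset) auto
  have finW: "finite W" unfolding W_def using finS by (intro finite_PiE) auto
  have n: "2 * j < n" "2 * j + 1 < n" if "j < N" for j using that unfolding N_def by auto
  have E: "E w (2 * j) = fst (w j)" "E w (2 * j + 1) = snd (w j)" if "j < N" for w j
    using that n[OF that] unfolding E_def by auto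
  have wS: "w j \<in> S" if "w \<in> W" "j < N" for w j using that unfolding W_def by auto
  have injE: "inj_on E W"
  proof (rule inj_onI)
    fix u w assume uw: "u \<in> W" "w \<in> W" "E u = E w"
    have "u j = w j" if "j < N" for j
      using E[OF that, of u] E[OF that, of w] uw(3) by (simp add: prod_eq_iff)
    then show "u = w" using uw(1,2) unfolding W_def by (intro PiE_ext[of u _ _ w]) auto
  qed
  have wt: "wt \<in> W \<rightarrow> {0..int (N * F)}"
  proof
    fix w assume w: "w \<in> W"
    have "0 \<le> wt w" unfolding wt_def using f wS[OF w] by (intro sum_nonneg) auto
    moreover have "wt w \<le> of_nat (card {..<N}) * int F"
      unfolding wt_def using f wS[OF w] by (intro sum_bounded_above) auto
    ultimately show "wt w \<in> {0..int (N * F)}" by simp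
  qed
  then obtain s where s: "card W \<le> card (wt -` {s} \<inter> W) * card {0..int (N * F)}"
    using pigeonhole_card[OF wt finW] by auto
  define A where "A = E ` (wt -` {s} \<inter> W)"
  have "card A = card (wt -` {s} \<inter> W)"
    unfolding A_def by (rule card_image) (rule inj_on_subset[OF injE], auto)
  moreover have "card W = card S ^ N" unfolding W_def by (simp add: card_funcsetE)
  ultimately have "card S ^ (n div 2) \<le> card A * (n div 2 * F + 1)"
    using s unfolding N_def by (simp add: nat_add_distrib nat_mult_distrib)
  moreover have "E w \<in> carrier (Zmod_power m n)" if w: "w \<in> W" for w
    unfolding carrier_Zmod_power[OF m]
  proof
    fix i assume "i \<in> {..<n}"
    show "E w i \<in> {0..<int m}"
    proof (cases "i div 2 < N")
      case True
      then have "w (i div 2) \<in> {0..<int m} \<times> {0..<int m}" using wS[OF w] S by blast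
      then show ?thesis using True \<open>i \<in> {..<n}\<close> unfolding E_def by (auto simp: mem_Times_iff)
    qed (use m \<open>i \<in> {..<n}\<close> in \<open>simp add: E_def\<close>)
  qed (simp add: E_def)
  then have "A \<subseteq> carrier (Zmod_power m n)" unfolding A_def by blast
  moreover have "three_term_ap_free (Zmod_power m n) A"
    unfolding three_term_ap_free_def
  proof
    assume "\<exists>x\<in>A. \<exists>y\<in>A. \<exists>z\<in>A. three_term_ap (Zmod_power m n) x y z"
    then obtain u v w where uvw: "u \<in> W" "v \<in> W" "w \<in> W" "wt u = s" "wt v = s" "wt w = s"
      and ap: "three_term_ap (Zmod_power m n) (E u) (E v) (E w)"
      unfolding A_def by auto
    have dv: "int m dvd fst (u j) + fst (w j) - 2 * fst (v j)"
      "int m dvd snd (u j) + snd (w j) - 2 * snd (v j)" if "j < N" for j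
      using three_term_ap_Zmod_powerD[OF ap n(1)[OF that] m]
        three_term_ap_Zmod_powerD[OF ap n(2)[OF that] m] E[OF that] by simp_all
    have le: "2 * f (v j) \<le> f (u j) + f (w j)" if "j < N" for j
      using midpoint_weightD(1)[OF mw _ _ _ dv] that uvw wS by blast
    \<comment> \<open>All three words have weight \<open>s\<close>, so the defects, nonnegative by
      \<open>le\<close>, sum to zero and each vanishes.\<close>
    have eq: "(\<Sum>j<N. f (u j) + f (w j) - 2 * f (v j)) = 0"
      using uvw(4-6) unfolding wt_def
      by (simp add: sum.distrib sum_subtractf flip: sum_distrib_left)
    have "f (u j) + f (w j) - 2 * f (v j) = 0" if "j < N" for j
      using eq le that by (subst (asm) sum_nonneg_eq_0_iff) auto
    then have "u j = w j" if "j < N" for j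
      using midpoint_weightD(2)[OF mw _ _ _ dv] that uvw wS by fastforce
    then have "u = w" using uvw(1,3) unfolding W_def by (intro PiE_ext[of u _ _ w]) auto
    then show False using ap unfolding three_term_ap_def by simp
  qed
  ultimately show ?thesis by blast
qed

section \<open>Asymptotics in the dimension\<close>

lemma exists_linear_le_power:
  fixes K r :: real
  assumes "1 < r"
  shows "\<exists>N\<^sub>0. \<forall>N\<ge>N\<^sub>0. K * (real N * F + 1) \<le> r ^ N"
proof -
  have "norm (inverse r) < 1" using assms by (simp add: field_simps)
  then have "(\<lambda>N. K * F * (of_nat N * inverse r ^ N) + K * inverse r ^ N) \<longlonglongrightarrow> K * F * 0 + K * 0"
    by (intro tendsto_intros powser_times_n_limit_0 LIMSEQ_power_zero)
  then have "\<forall>\<^sub>F N in sequentially. K * F * (of_nat N * inverse r ^ N) + K * inverse r ^ N < 1"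
    by (rule order_tendstoD) simp
  then obtain N0 where N0: "K * F * (of_nat N * inverse r ^ N) + K * inverse r ^ N < 1"
    if "N \<ge> N0" for N
    unfolding eventually_sequentially by auto
  have "K * (real N * F + 1) \<le> r ^ N" if "N \<ge> N0" for N
    using N0[OF that] assms by (simp add: field_simps)
  then show ?thesis by blast
qed

text \<open>The growth of \<open>(c' / c) ^ (2 * N)\<close> absorbs both the linear pigeonhole loss
  and the factor \<open>c * real m\<close> lost when \<open>n\<close> is odd. By
  \<open>1 <= c * real m\<close> the exponent \<open>n\<close> may be rounded up to
  \<open>2 * N + 1\<close>.\<close>

lemma exists_large_three_term_ap_free:
  fixes c c' :: real
  assumes m: "0 < m" and S: "S \<subseteq> {0..<int m} \<times> {0..<int m}"
    and mw: "midpoint_weight (int m) S f" and f: "\<And>p. p \<in> S \<Longrightarrow> 0 \<le> f p"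
    and c: "0 < c" "c < c'" "1 \<le> c * real m"
    and card: "(c' * real m)\<^sup>2 \<le> real (card S)"
  shows "\<exists>n\<^sub>0. \<forall>n\<ge>n\<^sub>0. \<exists>A. A \<subseteq> carrier (Zmod_power m n) \<and>
    (c * real m) ^ n \<le> real (card A) \<and> three_term_ap_free (Zmod_power m n) A"
proof -
  have "finite S" using S by (rule finite_subset) auto
  then have bdd: "f p \<le> int (nat (\<Sum>p\<in>S. f p))" if "p \<in> S" for p
    using member_le_sum[OF that, of f] f by (simp add: sum_nonneg)
  define F where "F = nat (\<Sum>p\<in>S. f p)"
  have "1 < (c' / c)\<^sup>2" using c by (simp add: one_less_power)
  then obtain N0 where N0: "c * real m * (real N * real F + 1) \<le> ((c' / c)\<^sup>2) ^ N" if "N \<ge> N0" for N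
    using exists_linear_le_power by blast
  have "\<exists>A. A \<subseteq> carrier (Zmod_power m n) \<and>
    (c * real m) ^ n \<le> real (card A) \<and> three_term_ap_free (Zmod_power m n) A"
    if n: "n \<ge> 2 * N0" for n
  proof -
    define N where "N = n div 2"
    obtain A where A: "A \<subseteq> carrier (Zmod_power m n)" "three_term_ap_free (Zmod_power m n) A"
      "card S ^ N \<le> card A * (N * F + 1)"
      using exists_three_term_ap_free_of_midpoint_weight[OF m S mw, of F n] f bdd
      unfolding N_def F_def by blast
    have "(c * real m) ^ n * (real N * real F + 1) \<le> (c * real m) ^ (2 * N + 1) * (real N * real F + 1)"
      using c by (intro mult_right_mono power_increasing) (auto simp: N_def)
    also have "\<dots> = (c * real m) ^ (2 * N) * (c * real m * (real N * real F + 1))"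
      by simp
    also have "\<dots> \<le> (c * real m) ^ (2 * N) * ((c' / c)\<^sup>2) ^ N"
      using c n by (intro mult_left_mono N0) (auto simp: N_def)
    also have "\<dots> = ((c * real m * (c' / c))\<^sup>2) ^ N"
      by (simp only: power_mult power_mult_distrib)
    also have "c * real m * (c' / c) = c' * real m" using c by simp
    also have "((c' * real m)\<^sup>2) ^ N \<le> real (card S) ^ N" using card by (intro power_mono) auto
    also have "\<dots> \<le> real (card A) * (real N * real F + 1)"
      using A(3)[THEN of_nat_mono, where 'a = real] by (simp add: distrib_left)
    finally have "(c * real m) ^ n \<le> real (card A)"
      by (rule mult_right_le_imp_le) (simp add: add_nonneg_pos)
    then show ?thesis using A by blast
  qed
  then show ?thesis by blast
qed

theorem theorem1p2:
  shows "\<exists>c::real. c > 1 / 2 \<and>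
    (\<forall>m::nat. m \<ge> 2 \<longrightarrow>
      (\<exists>n\<^sub>0::nat. \<forall>n::nat. n \<ge> n\<^sub>0 \<longrightarrow>
        (\<exists>A. A \<subseteq> carrier (Zmod_power m n) \<and>
             real (card A) \<ge> (c * real m) ^ n \<and>
             three_term_ap_free (Zmod_power m n) A)))"
\<comment> \<open>The constant lies strictly between \<open>1 / 2\<close> and the density root
  \<open>513 / 1024\<close> obtained below.\<close>
proof (intro exI[of _ "1025 / 2048"] conjI allI impI)
  fix m :: nat assume m: "m \<ge> 2"
  have "\<exists>S f. S \<subseteq> {0..<int m} \<times> {0..<int m} \<and> midpoint_weight (int m) S f \<and> (\<forall>p\<in>S. 0 \<le> f p) \<and>
    (513 / 1024 * real m)\<^sup>2 \<le> real (card S)"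
  proof (cases "m < 512")
    case True
    define k where "k = int m div 2"
    have k: "0 \<le> k" "2 * k \<le> int m" "int m \<le> 2 * k + 1" unfolding k_def by auto
    \<comment> \<open>As \<open>k + 1 >= (m + 1) / 2\<close>, this amounts to
      \<open>m <= 512\<close>.\<close>
    have "513 / 1024 * real m \<le> of_int (k + 1)" using True k by linarith
    then have "(513 / 1024 * real m)\<^sup>2 \<le> (of_int (k + 1))\<^sup>2" by (intro power_mono) auto
    moreover have "real (card ({0..k} \<times> {0..k})) = (of_int (k + 1))\<^sup>2"
      using k by (simp add: card_cartesian_product power2_eq_square)
    ultimately have "(513 / 1024 * real m)\<^sup>2 \<le> real (card ({0..k} \<times> {0..k}))" by simp
    moreover have "{0..k} \<times> {0..k} \<subseteq> {0..<int m} \<times> {0..<int m}" using k m by auto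
    ultimately show ?thesis
      using midpoint_weight_half_box[of k "int m"] k m
      by (intro exI[of _ "{0..k} \<times> {0..k}"] exI conjI) auto
  next
    case False
    define q where "q = int m div 16"
    have q: "16 * q \<le> int m" "int m \<le> 16 * q + 15" "32 \<le> q" using False unfolding q_def by auto
    \<comment> \<open>From \<open>q >= 32\<close> follows \<open>15 <= 16 * q / 32\<close>, hence
      the factor \<open>33 / 32\<close>; the resulting square is about
      \<open>68.4 * q\<^sup>2\<close>, below \<open>72 * q\<^sup>2\<close>.\<close>
    have "513 / 1024 * real m \<le> 513 / 1024 * (16 * 33 / 32 * of_int q)" using q by linarith
    then have "(513 / 1024 * real m)\<^sup>2 \<le> (513 / 1024 * (16 * 33 / 32 * of_int q))\<^sup>2"
      by (intro power_mono) auto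
    also have "\<dots> \<le> 72 * (of_int q)\<^sup>2" by (simp add: power2_eq_square)
    also have "\<dots> = real_of_int (72 * q\<^sup>2)" by simp
    also have "\<dots> \<le> real_of_int (int (card (staircase (int m) q)))"
      using card_staircase[of q "int m"] q by (simp only: of_int_le_iff)
    also have "\<dots> = real (card (staircase (int m) q))" by simp
    finally have "(513 / 1024 * real m)\<^sup>2 \<le> real (card (staircase (int m) q))" .
    moreover have "staircase (int m) q \<subseteq> {0..<int m} \<times> {0..<int m}"
      using q unfolding staircase_def by auto
    ultimately show ?thesis using midpoint_weight_staircase[of q "int m"] q
      by (intro exI[of _ "staircase (int m) q"] exI[of _ "staircase_weight (int m) q"])
        (auto simp: staircase_weight_def)
  qed
  then obtain S f where S: "S \<subseteq> {0..<int m} \<times> {0..<int m}" "midpoint_weight (int m) S f"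
    "\<And>p. p \<in> S \<Longrightarrow> 0 \<le> f p" "(513 / 1024 * real m)\<^sup>2 \<le> real (card S)"
    by blast
  show "\<exists>n\<^sub>0::nat. \<forall>n::nat. n \<ge> n\<^sub>0 \<longrightarrow>
        (\<exists>A. A \<subseteq> carrier (Zmod_power m n) \<and>
             real (card A) \<ge> (1025 / 2048 * real m) ^ n \<and>
             three_term_ap_free (Zmod_power m n) A)"
    using exists_large_three_term_ap_free[OF _ S(1-3) _ _ _ S(4), of "1025 / 2048"] m by simp
qed simp

end
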